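(* Let $j\ge 1$ and let $\omega^1,\ldots,\omega^j\in\mathcal I$ be irreducible bridges. Let $\mathcal H(\omega^1,\ldots,\omega^j)$ denote the set of $\omega\in\mathcal H$ of the form $$\omega=\omega^1\otimes\cdots\otimes\omega^j\otimes\tilde\omega,\qquad \tilde\omega\in\mathcal H.$$ Then for every $0<\beta<\beta_c$, $$\mathbf P_\beta[\mathcal H(\omega^1,\ldots,\omega^j)]=\beta^{|\omega^1|+\cdots+|\omega^j|}.$$ In particular, $$\lim_{\beta\to\beta_c-}\mathbf P_\beta[\mathcal H(\omega^1,\ldots,\omega^j)]=\beta_c^{|\omega^1|+\cdots+|\omega^j|}=Q^j(\omega^1\otimes\cdots\otimes\omega^j).$$
   Context: Write $\mathbb Z^2=\mathbb Z+i\mathbb Z\subset\mathbb C$. A self-avoiding walk (SAW) is a finite nearest-neighbor path $\omega=[\omega_0,\ldots,\omega_n]$ in $\mathbb Z^2$ with distinct vertices; $|\omega|=n$ is its number of steps, and $0$-step walks are allowed. If $C_n$ is the number of $n$-step SAWs with $\omega_0=0$, then $\beta_c$ is defined by $1/\beta_c=\lim_n C_n^{1/n}$ (so $0<\beta_c<1$ and $\beta_c$ is the radius of convergence of $\sum_n C_n\beta^n$). Concatenation: if $\omega^1=[\omega^1_0,\ldots,\omega^1_m]$ and $\omega^2=[0,\omega^2_1,\ldots,\omega^2_n]$, then $\omega^1\otimes\omega^2=[\omega^1_0,\ldots,\omega^1_m,\omega^1_m+\omega^2_1,\ldots,\omega^1_m+\omega^2_n]$; iterated concatenations are defined similarly.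 $\mathcal H$ is the set of half-plane SAWs: SAWs $\omega=[\omega_0=0,\ldots,\omega_n]$ with $\mathrm{Im}[\omega_j]>0$ for all $j>0$ (including the trivial walk $[0]$). The height $h(\omega)$ of $\omega\in\mathcal H$ is $\max_j\mathrm{Im}[\omega_j]$. A bridge is a walk $\omega=[\omega_0=0,\ldots,\omega_n]\in\mathcal H$ with $\mathrm{Im}[\omega_n]=h(\omega)$; $\mathcal B$ is the set of bridges and $\mathcal B^*$ the set of bridges with $h(\omega)\ge1$. An irreducible bridge is an element of $\mathcal B^*$ which cannot be written as $\omega^1\otimes\omega^2$ with $\omega^1,\omega^2\in\mathcal B^*$; $\mathcal I$ is the set of irreducible bridges. For $0<\beta<\beta_c$, $H(\beta)=\sum_{\omega\in\mathcal H}\beta^{|\omega|}<\infty$ and $\mathbf P_\beta$ is the probability measure on $\mathcal H$ with $\mathbf P_\beta(\omega)=\beta^{|\omega|}/H(\beta)$. It is a known fact (Kesten) that $\sum_{\omega\in\mathcal I}\beta_c^{|\omega|}=1$. $Q$ is the probability measure on $\mathcal I$ with $Q(\omega)=\beta_c^{|\omega|}$. $Q^j$ is the $j$-fold product measure on $\mathcal I^j$, regarded as a probability measure on $\mathcal B$ via $Q^j(\omega^1\otimes\cdots\otimes\omega^j)=Q(\omega^1)\cdots Q(\omega^j)$ for $\omega^1,\ldots,\omega^j\in\mathcal I$, and $Q^j(\omega)=0$ for bridges not of this form. *)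

theory Defs
  imports "HOL-Probability.Probability"
begin

text \<open>The lattice \<open>\<int> + i\<int>\<close> is represented by \<open>int \<times> int\<close>, so \<open>Im\<close> is \<^const>\<open>snd\<close>, and
  a walk \<open>[\<omega>\<^sub>0, \<dots>, \<omega>\<^sub>n]\<close> by the nonempty list of its \<open>n + 1\<close> vertices.\<close>

type_synonym walk = "(int \<times> int) list"

definition neighbor :: "int \<times> int \<Rightarrow> int \<times> int \<Rightarrow> bool" where
  "neighbor z w \<longleftrightarrow> \<bar>fst w - fst z\<bar> + \<bar>snd w - snd z\<bar> = 1"

definition saw :: "walk \<Rightarrow> bool" where
  "saw \<omega> \<longleftrightarrow> \<omega> \<noteq> [] \<and> distinct \<omega> \<and> successively neighbor \<omega>"

definition steps :: "walk \<Rightarrow> nat" where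
  "steps \<omega> = length \<omega> - 1"

definition saw_count :: "nat \<Rightarrow> nat" where
  "saw_count n = card {\<omega>. saw \<omega> \<and> hd \<omega> = 0 \<and> steps \<omega> = n}"

definition beta_c :: real where
  "beta_c = 1 / lim (\<lambda>n. root n (real (saw_count n)))"

text \<open>The second walk is meant to start at \<open>0\<close>; its initial vertex is dropped.\<close>

definition walk_concat :: "walk \<Rightarrow> walk \<Rightarrow> walk" (infixr \<open>\<otimes>\<^sub>w\<close> 65) where
  "\<omega>1 \<otimes>\<^sub>w \<omega>2 = \<omega>1 @ map (\<lambda>z. last \<omega>1 + z) (tl \<omega>2)"

text \<open>The trailing trivial walk \<open>[0]\<close> is neutral, so for a nonempty list this is
  \<open>\<omega>\<^sup>1 \<otimes>\<^sub>w \<dots> \<otimes>\<^sub>w \<omega>\<^sup>j\<close>.\<close>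

definition walk_concats :: "walk list \<Rightarrow> walk" where
  "walk_concats \<omega>s = foldr (\<otimes>\<^sub>w) \<omega>s [0]"

definition half_plane_saws :: "walk set" where
  "half_plane_saws = {\<omega>. saw \<omega> \<and> hd \<omega> = 0 \<and> (\<forall>z\<in>set (tl \<omega>). snd z > 0)}"

definition height :: "walk \<Rightarrow> int" where
  "height \<omega> = Max (snd ` set \<omega>)"

definition bridges :: "walk set" where
  "bridges = {\<omega> \<in> half_plane_saws. snd (last \<omega>) = height \<omega>}"

definition pos_bridges :: "walk set" where
  "pos_bridges = {\<omega> \<in> bridges. height \<omega> \<ge> 1}"

definition irreducible_bridges :: "walk set" where
  "irreducible_bridges =
     {\<omega> \<in> pos_bridges. \<not> (\<exists>\<omega>1\<in>pos_bridges. \<exists>\<omega>2\<in>pos_bridges. \<omega> = \<omega>1 \<otimes>\<^sub>w \<omega>2)}"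

definition H_fun :: "real \<Rightarrow> real" where
  "H_fun \<beta> = (\<Sum>\<^sub>\<infinity>\<omega>\<in>half_plane_saws. \<beta> ^ steps \<omega>)"

definition P_measure :: "real \<Rightarrow> walk measure" where
  "P_measure \<beta> = point_measure half_plane_saws (\<lambda>\<omega>. ennreal (\<beta> ^ steps \<omega> / H_fun \<beta>))"

definition half_plane_extensions :: "walk list \<Rightarrow> walk set" where
  "half_plane_extensions \<omega>s =
     {\<omega> \<in> half_plane_saws. \<exists>\<omega>'\<in>half_plane_saws. \<omega> = foldr (\<otimes>\<^sub>w) \<omega>s \<omega>'}"

definition Q_measure :: "walk measure" where
  "Q_measure = point_measure irreducible_bridges (\<lambda>\<omega>. ennreal (beta_c ^ steps \<omega>))"

text \<open>The image on bridges of the \<open>j\<close>-fold product of \<^const>\<open>Q_measure\<close> under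
  \<open>(\<omega>\<^sup>1, \<dots>, \<omega>\<^sup>j) \<mapsto> \<omega>\<^sup>1 \<otimes>\<^sub>w \<dots> \<otimes>\<^sub>w \<omega>\<^sup>j\<close>.\<close>

definition Q_power :: "nat \<Rightarrow> walk measure" where
  "Q_power j = distr (PiM {..<j} (\<lambda>_. Q_measure)) (count_space bridges)
     (\<lambda>w. walk_concats (map w [0..<j]))"

end

theory Submission
  imports Defs
begin

text \<open>Attaching \<open>\<omega>\<^sup>1, \<dots>, \<omega>\<^sup>j\<close> in front of a half-plane walk multiplies its weight \<open>\<beta>\<^bsup>|\<omega>|\<^esup>\<close>
  by the constant \<open>\<beta>\<^bsup>|\<omega>\<^sup>1| + \<dots> + |\<omega>\<^sup>j|\<^esup>\<close>. The result is again a half-plane walk, since a bridge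
  ends at its maximal height and the attached walk stays strictly above that level
  (\<open>walk_concat_in_half_plane_saws\<close>), and nothing is counted twice
  (\<open>foldr_concat_unique\<close>). Hence the walks with the prescribed beginning carry exactly this
  fraction of the total weight \<open>H(\<beta>)\<close>. The normalised weights sum to \<open>1\<close> once \<open>H(\<beta>)\<close> is known
  to be finite.

  Finiteness of \<open>H(\<beta>)\<close> for \<open>\<beta> < \<beta>\<^sub>c\<close> comes from the root test. It rests on the existence of the
  limit in the definition of \<open>\<beta>\<^sub>c\<close>, which is Fekete's lemma for the submultiplicative numbers of
  self-avoiding walks (\<open>fekete_nonneg\<close>, \<open>saw_count_submultiplicative\<close>). Positivity of
  \<open>\<beta>\<^sub>c\<close> also makes the interval \<open>(0, \<beta>\<^sub>c)\<close> a left neighbourhood of \<open>\<beta>\<^sub>c\<close>, so that the limit statement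
  reduces to continuity of a power.

  For the last equality, uniqueness of the decomposition into irreducible bridges shows that the
  event in the product space is a single point, whose mass is the product of the weights of its
  coordinates. The argument takes place in a countable discrete space with finite
  point masses, so the factors are \<open>\<sigma>\<close>-finite and boxes have product measure.\<close>

section \<open>Concatenation and splitting of walks\<close>

text \<open>Every factorisation of a vertex list is a concatenation: the second walk is the remainder, moved
  so that it starts at the origin.\<close>

lemma walk_concat_split:
  "u \<otimes>\<^sub>w (0 # map (\<lambda>z. z - last u) v) = u @ v"
  by (simp add: walk_concat_def o_def)

lemma neighbor_diff: "neighbor (z - c) (w - c) \<longleftrightarrow> neighbor z w"
  by (simp add: neighbor_def)

lemma neighbor_add: "neighbor (c + z) (c + w) \<longleftrightarrow> neighbor z w"
  by (simp add: neighbor_def)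

lemma neighbor_add_right: "neighbor c (c + w) \<longleftrightarrow> neighbor 0 w"
  by (simp add: neighbor_def)

lemma saw_append_left:
  assumes "saw (u @ v)" "u \<noteq> []"
  shows "saw u"
  using assms by (simp add: saw_def successively_append_iff)

lemma saw_append_right:
  assumes "saw (u @ v)" "u \<noteq> []"
  shows "saw (0 # map (\<lambda>z. z - last u) v)"
proof -
  have "saw (last u # v)"
    using assms last_in_set[OF assms(2)]
    by (auto simp: saw_def successively_append_iff successively_Cons simp del: last_in_set)
  then have "saw (map (\<lambda>z. z - last u) (last u # v))"
    unfolding saw_def successively_map neighbor_diff
    by (simp add: distinct_map inj_on_def image_iff del: list.map)
  then show ?thesis by simp
qed

lemma steps_walk_concat:
  assumes "u \<noteq> []" "v \<noteq> []"
  shows "steps (u \<otimes>\<^sub>w v) = steps u + steps v"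
  using assms by (cases u; cases v) (auto simp: steps_def walk_concat_def)

section \<open>The connective constant\<close>

text \<open>By induction on the length: the second vertex lies in the \<open>3 \<times> 3\<close> box around the first one,
  so there are finitely many choices for it.\<close>

lemma finite_saws_from:
  "finite {\<omega>. successively neighbor \<omega> \<and> \<omega> \<noteq> [] \<and> hd \<omega> = z \<and> length \<omega> = n}"
proof (induction n arbitrary: z)
  case 0
  then show ?case by simp
next
  case (Suc n)
  let ?W = "\<lambda>z n. {\<omega>. successively neighbor \<omega> \<and> \<omega> \<noteq> [] \<and> hd \<omega> = z \<and> length \<omega> = n}"
  let ?N = "{fst z - 1..fst z + 1} \<times> {snd z - 1..snd z + 1}"
  have "?W z (Suc n) \<subseteq> insert [z] ((#) z ` (\<Union>w\<in>?N. ?W w n))"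
  proof
    fix \<omega> assume *: "\<omega> \<in> ?W z (Suc n)"
    then obtain t where t: "\<omega> = z # t" by (cases \<omega>) auto
    show "\<omega> \<in> insert [z] ((#) z ` (\<Union>w\<in>?N. ?W w n))"
    proof (cases "t = []")
      case False
      then have "neighbor z (hd t)" "successively neighbor t" "length t = n"
        using * t by (auto simp: successively_Cons)
      moreover from this(1) have "hd t \<in> ?N"
        by (cases "hd t") (auto simp: neighbor_def)
      ultimately show ?thesis using False t by blast
    qed (simp add: t)
  qed
  moreover have "finite (insert [z] ((#) z ` (\<Union>w\<in>?N. ?W w n)))"
    using Suc by auto
  ultimately show ?case by (rule finite_subset)
qed

lemma finite_saws: "finite {\<omega>. saw \<omega> \<and> hd \<omega> = 0 \<and> steps \<omega> = n}"
  by (rule finite_subset[OF _ finite_saws_from[of 0 "Suc n"]]) (auto simp: saw_def steps_def)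

lemma saw_count_pos: "saw_count n > 0"
proof -
  \<comment> \<open>The vertical segment of length \<open>n\<close> is self-avoiding.\<close>
  let ?\<omega> = "map (\<lambda>k. (0::int, int k)) [0..<Suc n]"
  have "saw ?\<omega> \<and> hd ?\<omega> = 0 \<and> steps ?\<omega> = n"
    by (simp add: saw_def steps_def distinct_map inj_on_def successively_conv_nth neighbor_def
        hd_map zero_prod_def del: upt_Suc)
  then show ?thesis
    unfolding saw_count_def card_gt_0_iff using finite_saws by blast
qed

text \<open>Cutting a walk of \<open>m + n\<close> steps after \<open>m\<close> steps gives two self-avoiding walks that determine it.\<close>

lemma saw_count_submultiplicative: "saw_count (m + n) \<le> saw_count m * saw_count n"
proof -
  let ?S = "\<lambda>n. {\<omega>. saw \<omega> \<and> hd \<omega> = 0 \<and> steps \<omega> = n}"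
  have "?S (m + n) \<subseteq> (\<lambda>(u, v). u \<otimes>\<^sub>w v) ` (?S m \<times> ?S n)"
  proof
    fix \<omega> assume *: "\<omega> \<in> ?S (m + n)"
    define u v where "u = take (Suc m) \<omega>" and "v = drop (Suc m) \<omega>"
    define r where "r = 0 # map (\<lambda>z. z - last u) v"
    have len: "length \<omega> = Suc (m + n)"
      using * by (cases \<omega>) (auto simp: saw_def steps_def)
    have uv: "\<omega> = u @ v" "u \<noteq> []" "length u = Suc m" "length v = n"
      using len by (auto simp: u_def v_def)
    have "saw u" "saw r"
      using * saw_append_left[of u v] saw_append_right[of u v] by (simp_all add: uv(1,2) r_def)
    moreover have "hd u = 0" using * by (simp add: uv(1,2))
    ultimately have "u \<in> ?S m" "r \<in> ?S n"
      using uv by (simp_all add: r_def steps_def)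
    moreover have "\<omega> = u \<otimes>\<^sub>w r" by (simp add: r_def uv walk_concat_split)
    ultimately show "\<omega> \<in> (\<lambda>(u, v). u \<otimes>\<^sub>w v) ` (?S m \<times> ?S n)" by blast
  qed
  then have "card (?S (m + n)) \<le> card (?S m \<times> ?S n)"
    by (rule surj_card_le[rotated]) (intro finite_cartesian_product finite_saws)
  then show ?thesis by (simp add: saw_count_def card_cartesian_product)
qed

text \<open>Fekete's lemma; nonnegativity makes the infimum of \<open>a n / n\<close> finite, and this infimum is the
  limit. If \<open>a m / m\<close> is close to the infimum, division with remainder by \<open>m\<close> bounds \<open>a n\<close> by
  \<open>(n / m) a m\<close> up to a constant, which disappears after dividing by \<open>n\<close>.\<close>

lemma fekete_nonneg:
  fixes a :: "nat \<Rightarrow> real"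
  assumes sub: "\<And>m n. a (m + n) \<le> a m + a n" and nonneg: "\<And>n. 0 \<le> a n"
  shows "\<exists>l. (\<lambda>n. a n / real n) \<longlonglongrightarrow> l"
proof -
  define l where "l = (INF n\<in>{1..}. a n / real n)"
  have bdd: "bdd_below ((\<lambda>n. a n / real n) ` {1..})"
    by (intro bdd_belowI2[of _ 0]) (simp add: nonneg)
  have lower: "l \<le> a n / real n" if "n \<ge> 1" for n
    unfolding l_def by (rule cINF_lower[OF bdd]) (use that in simp)
  have mult: "a (q * m + r) \<le> real q * a m + a r" for q m r
  proof (induction q)
    case (Suc q)
    have "a (Suc q * m + r) \<le> a m + a (q * m + r)"
      using sub[of m "q * m + r"] by (simp add: algebra_simps)
    then show ?case using Suc by (simp add: algebra_simps)
  qed simp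
  have "(\<lambda>n. a n / real n) \<longlonglongrightarrow> l"
  proof (rule order_tendstoI)
    fix y assume "y < l"
    then show "\<forall>\<^sub>F n in sequentially. y < a n / real n"
      using lower by (intro eventually_sequentiallyI[of 1]) (meson less_le_trans)
  next
    fix y assume "l < y"
    then obtain m where m: "m \<ge> 1" "a m / real m < y"
      unfolding l_def by (subst (asm) cINF_less_iff[OF _ bdd]) auto
    \<comment> \<open>\<open>K\<close> absorbs the contribution of the remainder of \<open>n\<close> modulo \<open>m\<close>.\<close>
    define K where "K = Max (a ` {..<m})"
    have K: "a r \<le> K" if "r < m" for r
      unfolding K_def using that by simp
    have bound: "a n / real n \<le> a m / real m + K / real n" if "n \<ge> 1" for n
    proof -
      have "a n \<le> real (n div m) * a m + a (n mod m)"
        using mult[of "n div m" m "n mod m"] by simp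
      also have "\<dots> \<le> real n / real m * a m + K"
        using m K of_nat_div_le_of_nat[of n m, where 'a = real]
        by (intro add_mono mult_right_mono nonneg) auto
      finally show ?thesis using that m by (simp add: field_simps)
    qed
    have "(\<lambda>n. a m / real m + K / real n) \<longlonglongrightarrow> a m / real m + 0"
      by (intro tendsto_intros lim_const_over_n)
    then have "\<forall>\<^sub>F n in sequentially. a m / real m + K / real n < y"
      using m by (intro order_tendstoD) simp_all
    moreover have "\<forall>\<^sub>F n :: nat in sequentially. n \<ge> 1"
      by (rule eventually_ge_at_top)
    ultimately show "\<forall>\<^sub>F n in sequentially. a n / real n < y"
      by eventually_elim (use bound in fastforce)
  qed
  then show ?thesis by blast
qed

text \<open>Fekete's lemma applies to the logarithms of the walk counts. The limit of the roots is an
  exponential, hence positive; so \<open>\<beta>\<^sub>c\<close> is not a value of \<open>lim\<close> at a divergent sequence nor the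
  default value of a division by zero.\<close>

lemma connective_constant:
  obtains \<mu> where "\<mu> > 0" "(\<lambda>n. root n (real (saw_count n))) \<longlonglongrightarrow> \<mu>" "beta_c = 1 / \<mu>"
proof -
  define a where "a n = ln (real (saw_count n))" for n
  have "a (m + n) \<le> a m + a n" for m n
  proof -
    have "real (saw_count (m + n)) \<le> real (saw_count m) * real (saw_count n)"
      using saw_count_submultiplicative[of m n] by (metis of_nat_le_iff of_nat_mult)
    then have "a (m + n) \<le> ln (real (saw_count m) * real (saw_count n))"
      unfolding a_def using saw_count_pos[of "m + n"] by (intro ln_mono) auto
    also have "\<dots> = a m + a n"
      unfolding a_def using saw_count_pos[of m] saw_count_pos[of n] by (simp add: ln_mult)
    finally show ?thesis .
  qed
  moreover have "0 \<le> a n" for n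
    unfolding a_def using saw_count_pos[of n] by (intro ln_ge_zero) linarith
  ultimately obtain l where l: "(\<lambda>n. a n / real n) \<longlonglongrightarrow> l"
    using fekete_nonneg by blast
  have "(\<lambda>n. root n (real (saw_count n))) \<longlonglongrightarrow> exp l"
  proof (rule Lim_transform_eventually[OF tendsto_exp[OF l]])
    show "\<forall>\<^sub>F n in sequentially. exp (a n / real n) = root n (real (saw_count n))"
      using saw_count_pos
      by (intro eventually_sequentiallyI[of 1])
        (simp add: root_powr_inverse powr_def a_def field_simps)
  qed
  then show thesis
    using that[of "exp l"] limI by (auto simp: beta_c_def)
qed

lemma beta_c_pos: "beta_c > 0"
proof -
  obtain \<mu> where "\<mu> > 0" "beta_c = 1 / \<mu>" by (rule connective_constant)
  then show ?thesis by (metis zero_less_divide_1_iff)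
qed

text \<open>Root test: the \<open>n\<close>-th roots of the terms converge to \<open>\<beta> / \<beta>\<^sub>c < 1\<close>.\<close>

lemma summable_saw_count:
  assumes "0 < \<beta>" "\<beta> < beta_c"
  shows "summable (\<lambda>n. real (saw_count n) * \<beta> ^ n)"
proof -
  obtain \<mu> where \<mu>: "\<mu> > 0" "(\<lambda>n. root n (real (saw_count n))) \<longlonglongrightarrow> \<mu>" "beta_c = 1 / \<mu>"
    by (rule connective_constant)
  have "(\<lambda>n. root n (norm (real (saw_count n) * \<beta> ^ n))) \<longlonglongrightarrow> \<mu> * \<beta>"
  proof (rule Lim_transform_eventually[OF tendsto_mult_right[OF \<mu>(2)]])
    show "\<forall>\<^sub>F n in sequentially.
        root n (real (saw_count n)) * \<beta> = root n (norm (real (saw_count n) * \<beta> ^ n))"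
      using assms
      by (intro eventually_sequentiallyI[of 1]) (simp add: real_root_mult real_root_power_cancel)
  qed
  then have "limsup (\<lambda>n. ereal (root n (norm (real (saw_count n) * \<beta> ^ n)))) = ereal (\<mu> * \<beta>)"
    by (intro lim_imp_Limsup) auto
  moreover have "\<mu> * \<beta> < 1"
    using assms(2) \<mu>(1) unfolding \<mu>(3) by (simp add: less_divide_eq mult.commute)
  ultimately show ?thesis
    by (intro root_test_convergence') simp
qed

text \<open>Grouping a finite set of walks by length bounds its weight by the generating series of all
  self-avoiding walks.\<close>

lemma summable_on_half_plane_saws:
  assumes "0 < \<beta>" "\<beta> < beta_c"
  shows "(\<lambda>\<omega>. \<beta> ^ steps \<omega>) summable_on half_plane_saws"
proof (rule nonneg_bdd_above_summable_on)
  let ?S = "\<lambda>n. {\<omega>. saw \<omega> \<and> hd \<omega> = 0 \<and> steps \<omega> = n}"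
  show "bdd_above (sum (\<lambda>\<omega>. \<beta> ^ steps \<omega>) ` {F. F \<subseteq> half_plane_saws \<and> finite F})"
  proof (rule bdd_aboveI2)
    fix F :: "walk set" assume "F \<in> {F. F \<subseteq> half_plane_saws \<and> finite F}"
    then have F: "F \<subseteq> half_plane_saws" "finite F" by auto
    have "(\<Sum>\<omega>\<in>F. \<beta> ^ steps \<omega>) = (\<Sum>n\<in>steps ` F. \<Sum>\<omega>\<in>{\<omega>\<in>F. steps \<omega> = n}. \<beta> ^ steps \<omega>)"
      using F(2) by (rule sum.image_gen)
    also have "\<dots> \<le> (\<Sum>n\<in>steps ` F. real (saw_count n) * \<beta> ^ n)"
    proof (rule sum_mono)
      fix n
      have "{\<omega>\<in>F. steps \<omega> = n} \<subseteq> ?S n"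
        using F by (auto simp: half_plane_saws_def)
      then have "card {\<omega>\<in>F. steps \<omega> = n} \<le> saw_count n"
        unfolding saw_count_def by (rule card_mono[OF finite_saws])
      then show "(\<Sum>\<omega>\<in>{\<omega>\<in>F. steps \<omega> = n}. \<beta> ^ steps \<omega>) \<le> real (saw_count n) * \<beta> ^ n"
        using assms by (simp add: mult_right_mono)
    qed
    also have "\<dots> \<le> (\<Sum>n. real (saw_count n) * \<beta> ^ n)"
      using summable_saw_count[OF assms] F assms by (intro sum_le_suminf) auto
    finally show "(\<Sum>\<omega>\<in>F. \<beta> ^ steps \<omega>) \<le> (\<Sum>n. real (saw_count n) * \<beta> ^ n)" .
  qed
qed (use assms in simp)

section \<open>Bridges and their irreducible decomposition\<close>

lemma half_plane_saws_Cons: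
  assumes "\<omega> \<in> half_plane_saws"
  obtains t where "\<omega> = 0 # t" "\<forall>z\<in>set t. snd z > 0"
  using assms by (cases \<omega>) (auto simp: half_plane_saws_def saw_def)

lemma trivial_walk_in_half_plane_saws: "[0] \<in> half_plane_saws"
  by (simp add: half_plane_saws_def saw_def)

lemma snd_last_eq_height_iff:
  assumes "\<omega> \<noteq> []"
  shows "snd (last \<omega>) = height \<omega> \<longleftrightarrow> (\<forall>z\<in>set \<omega>. snd z \<le> snd (last \<omega>))"
proof -
  have "height \<omega> = snd (last \<omega>) \<longleftrightarrow> (\<forall>y\<in>snd ` set \<omega>. y \<le> snd (last \<omega>))"
    unfolding height_def using assms by (subst Max_eq_iff) auto
  then show ?thesis by auto
qed

text \<open>The maximum in the height is replaced by a pointwise bound, which can be checked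
  separately on the two parts of a concatenation.\<close>

lemma bridges_iff:
  "\<omega> \<in> bridges \<longleftrightarrow> \<omega> \<in> half_plane_saws \<and> (\<forall>z\<in>set \<omega>. snd z \<le> snd (last \<omega>))"
  using snd_last_eq_height_iff[of \<omega>] by (auto simp: bridges_def half_plane_saws_def saw_def)

lemma pos_bridges_iff: "\<omega> \<in> pos_bridges \<longleftrightarrow> \<omega> \<in> bridges \<and> snd (last \<omega>) \<ge> 1"
  by (auto simp: pos_bridges_def bridges_def)

lemma irreducible_bridges_subset: "irreducible_bridges \<subseteq> bridges"
  by (auto simp: irreducible_bridges_def pos_bridges_def)

text \<open>The bridge stays at or below the height of its endpoint, and the attached part strictly above it,
  so the two parts cannot meet.\<close>

lemma walk_concat_in_half_plane_saws:
  assumes "u \<in> bridges" "v \<in> half_plane_saws"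
  shows "u \<otimes>\<^sub>w v \<in> half_plane_saws"
proof -
  obtain t where t: "v = 0 # t" "\<forall>z\<in>set t. snd z > 0"
    using assms(2) by (rule half_plane_saws_Cons)
  have u: "saw u" "hd u = 0" "\<forall>z\<in>set (tl u). snd z > 0" "\<forall>z\<in>set u. snd z \<le> snd (last u)"
    using assms(1) by (auto simp: bridges_iff half_plane_saws_def)
  have ne: "u \<noteq> []" using u by (simp add: saw_def)
  have "0 \<le> snd (last u)" using u ne by (metis hd_in_set snd_zero)
  have v: "distinct t" "t = [] \<or> neighbor 0 (hd t)" "successively neighbor t"
    using assms(2) by (auto simp: t(1) half_plane_saws_def saw_def successively_Cons)
  have "distinct (u @ map (\<lambda>z. last u + z) t)"
    using u ne v(1) t(2) by (fastforce simp: saw_def distinct_map inj_on_def)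
  moreover have "successively neighbor (u @ map (\<lambda>z. last u + z) t)"
    using u(1) ne v(2,3)
    by (cases "t = []") (simp_all add: saw_def successively_append_iff successively_map
        neighbor_add neighbor_add_right hd_map del: split_paired_All)
  moreover have "\<forall>z\<in>set (tl u @ map (\<lambda>z. last u + z) t). snd z > 0"
    using u(3) t(2) \<open>0 \<le> snd (last u)\<close> by (auto simp: add_nonneg_pos simp del: split_paired_All)
  ultimately show ?thesis
    using ne u(2) by (simp add: t(1) walk_concat_def half_plane_saws_def saw_def)
qed

lemma walk_concat_in_bridges:
  assumes "u \<in> bridges" "v \<in> bridges"
  shows "u \<otimes>\<^sub>w v \<in> bridges"
proof -
  obtain t where t: "v = 0 # t" "\<forall>z\<in>set t. snd z > 0"
    using assms(2) half_plane_saws_Cons by (auto simp: bridges_iff)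
  have u: "\<forall>z\<in>set u. snd z \<le> snd (last u)" and v: "\<forall>z\<in>set t. snd z \<le> snd (last v)"
    using assms by (auto simp: bridges_iff t(1))
  have "\<forall>z\<in>set (u \<otimes>\<^sub>w v). snd z \<le> snd (last (u \<otimes>\<^sub>w v))"
  proof (cases "t = []")
    case True
    then show ?thesis using u by (simp add: t(1) walk_concat_def)
  next
    case False
    then have last: "last (u \<otimes>\<^sub>w v) = last u + last t"
      by (simp add: t(1) walk_concat_def last_map)
    moreover have "snd (last t) > 0" using False t(2) by simp
    ultimately have "snd z \<le> snd (last (u \<otimes>\<^sub>w v))" if "z \<in> set u" for z
      using u that by fastforce
    moreover have "snd (last u + z) \<le> snd (last (u \<otimes>\<^sub>w v))" if "z \<in> set t" for z
      using v that False by (simp only: last) (simp add: t(1))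
    moreover have "set (u \<otimes>\<^sub>w v) = set u \<union> (\<lambda>z. last u + z) ` set t"
      by (simp add: t(1) walk_concat_def)
    ultimately show ?thesis by (metis UnE imageE)
  qed
  moreover have "u \<otimes>\<^sub>w v \<in> half_plane_saws"
    using assms walk_concat_in_half_plane_saws by (auto simp: bridges_iff)
  ultimately show ?thesis by (simp add: bridges_iff)
qed

text \<open>Suppose the first factor \<open>v\<close> were longer than \<open>u\<close>. Then \<open>u\<close> is an initial piece of \<open>v\<close>, and
  the rest \<open>w\<close> of \<open>v\<close> belongs to the translate of the half-plane walk \<open>x\<close>, so it lies strictly
  above the endpoint of \<open>u\<close>. Since \<open>w\<close> ends at the maximal height of \<open>v\<close>, moving its start to the origin
  gives a bridge of positive height, and \<open>v\<close> would be reducible.\<close>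

lemma irreducible_prefix_not_longer:
  assumes u: "u \<in> irreducible_bridges" and v: "v \<in> irreducible_bridges"
    and x: "x \<in> half_plane_saws" and eq: "u \<otimes>\<^sub>w x = v \<otimes>\<^sub>w y"
  shows "length v \<le> length u"
proof (rule ccontr)
  assume "\<not> length v \<le> length u"
  then have less: "length u < length v" by simp
  obtain t where t: "x = 0 # t" "\<forall>z\<in>set t. snd z > 0"
    using x by (rule half_plane_saws_Cons)
  define w where "w = drop (length u) v"
  have "take (length u) (u \<otimes>\<^sub>w x) = take (length u) (v \<otimes>\<^sub>w y)" by (simp add: eq)
  then have "u = take (length u) v" using less by (simp add: walk_concat_def)
  then have vw: "v = u @ w" unfolding w_def by (metis append_take_drop_id)
  have "w \<noteq> []" using less by (simp add: w_def)
  have up: "u \<in> pos_bridges" and vp: "v \<in> pos_bridges"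
    using u v by (auto simp: irreducible_bridges_def)
  have "u \<noteq> []" "saw v"
    using up vp by (auto simp: pos_bridges_iff bridges_iff half_plane_saws_def saw_def)
  have "map (\<lambda>z. last u + z) t = w @ map (\<lambda>z. last v + z) (tl y)"
    using eq by (simp add: vw walk_concat_def t(1))
  then have "set w \<subseteq> (\<lambda>z. last u + z) ` set t" by (metis Un_upper1 set_append set_map)
  then have "\<forall>z\<in>set w. \<exists>z'\<in>set t. z = last u + z'" by blast
  then have above: "\<forall>z\<in>set w. snd z > snd (last u)" using t(2) by fastforce
  let ?r = "0 # map (\<lambda>z. z - last u) w"
  have "?r \<in> half_plane_saws"
    using saw_append_right[of u w] \<open>u \<noteq> []\<close> \<open>saw v\<close> above
    by (auto simp: vw half_plane_saws_def)
  moreover have last: "snd (last ?r) = snd (last v) - snd (last u)"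
    using \<open>w \<noteq> []\<close> by (simp add: vw last_map)
  moreover have "snd (last v) > snd (last u)" using above \<open>w \<noteq> []\<close> by (simp add: vw)
  moreover have "\<forall>z\<in>set w. snd z \<le> snd (last v)"
    using vp by (simp add: vw pos_bridges_iff bridges_iff)
  ultimately have "?r \<in> pos_bridges"
    unfolding pos_bridges_iff bridges_iff last by auto
  moreover have "v = u \<otimes>\<^sub>w ?r" by (simp add: vw walk_concat_split)
  ultimately show False using up v by (auto simp: irreducible_bridges_def)
qed

lemma irreducible_prefix_unique:
  assumes "u \<in> irreducible_bridges" "v \<in> irreducible_bridges"
    and xy: "x \<in> half_plane_saws" "y \<in> half_plane_saws" and eq: "u \<otimes>\<^sub>w x = v \<otimes>\<^sub>w y"
  shows "u = v \<and> x = y"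
proof -
  have "length u = length v"
    using irreducible_prefix_not_longer[OF assms(1-3) eq]
      irreducible_prefix_not_longer[OF assms(2,1,4) eq[symmetric]] by simp
  then have "u = v" "map ((+) (last u)) (tl x) = map ((+) (last v)) (tl y)"
    using eq by (auto simp: walk_concat_def)
  then have "u = v" "tl x = tl y"
    by (auto simp: inj_map_eq_map)
  then show ?thesis
    using xy by (elim half_plane_saws_Cons) simp
qed

lemma foldr_concat_in_half_plane_saws:
  assumes "set us \<subseteq> irreducible_bridges" "x \<in> half_plane_saws"
  shows "foldr (\<otimes>\<^sub>w) us x \<in> half_plane_saws"
  using assms irreducible_bridges_subset
  by (induction us) (auto intro: walk_concat_in_half_plane_saws)

text \<open>The number of irreducible factors must be fixed on both sides, because the remaining walk may
  itself begin with an irreducible bridge.\<close>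

lemma foldr_concat_unique:
  assumes "set us \<subseteq> irreducible_bridges" "set vs \<subseteq> irreducible_bridges" "length us = length vs"
    and "x \<in> half_plane_saws" "y \<in> half_plane_saws"
    and "foldr (\<otimes>\<^sub>w) us x = foldr (\<otimes>\<^sub>w) vs y"
  shows "us = vs \<and> x = y"
  using assms(3,1,2,6)
proof (induction us vs rule: list_induct2)
  case Nil
  then show ?case by simp
next
  case (Cons u us v vs)
  then have "u = v \<and> foldr (\<otimes>\<^sub>w) us x = foldr (\<otimes>\<^sub>w) vs y"
    using assms(4,5)
    by (intro irreducible_prefix_unique) (auto intro: foldr_concat_in_half_plane_saws)
  with Cons show ?case by auto
qed

lemma steps_foldr_concat:
  assumes "set us \<subseteq> irreducible_bridges" "x \<in> half_plane_saws"
  shows "steps (foldr (\<otimes>\<^sub>w) us x) = (\<Sum>u\<leftarrow>us. steps u) + steps x"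
  using assms
proof (induction us)
  case (Cons u us)
  have "u \<noteq> []" "foldr (\<otimes>\<^sub>w) us x \<noteq> []"
    using Cons.prems irreducible_bridges_subset foldr_concat_in_half_plane_saws[of us x]
    by (auto simp: bridges_iff half_plane_saws_def saw_def)
  with Cons show ?case by (simp add: steps_walk_concat)
qed simp

lemma walk_concats_in_bridges:
  assumes "set us \<subseteq> irreducible_bridges"
  shows "walk_concats us \<in> bridges"
  using assms irreducible_bridges_subset trivial_walk_in_half_plane_saws
  unfolding walk_concats_def
  by (induction us) (auto intro: walk_concat_in_bridges simp: bridges_iff[of "[0]"])

section \<open>Probabilities of prescribed initial bridges\<close>

lemma emeasure_point_measure_eq_nn_integral:
  assumes "X \<subseteq> A"
  shows "emeasure (point_measure A f) X = (\<integral>\<^sup>+x. f x \<partial>count_space X)"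
proof -
  have "emeasure (point_measure A f) X = (\<integral>\<^sup>+x. f x * indicator X x \<partial>count_space A)"
    unfolding point_measure_def using assms by (subst emeasure_density) auto
  also have "\<dots> = (\<integral>\<^sup>+x. f x \<partial>count_space X)"
    using assms
    by (subst nn_integral_restrict_space[symmetric]) (auto simp: restrict_count_space Int_absorb2)
  finally show ?thesis .
qed

text \<open>\<open>H(\<beta>)\<close> is a real infinite sum, which would be \<open>0\<close> by default if the series diverged; summability
  is what identifies it with the extended nonnegative integral.\<close>

lemma nn_integral_half_plane_saws:
  assumes "0 < \<beta>" "\<beta> < beta_c"
  shows "(\<integral>\<^sup>+\<omega>. ennreal (\<beta> ^ steps \<omega> / H_fun \<beta>) \<partial>count_space half_plane_saws) = 1"
proof -
  let ?f = "\<lambda>\<omega>::walk. \<beta> ^ steps \<omega>"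
  have sum: "?f summable_on half_plane_saws"
    by (rule summable_on_half_plane_saws[OF assms])
  then have "Infinite_Sum.abs_summable_on ?f half_plane_saws"
    using assms by simp
  then have abs: "Infinite_Set_Sum.abs_summable_on ?f half_plane_saws"
    by (simp only: abs_summable_equivalent)
  \<comment> \<open>The trivial walk contributes \<open>1\<close>, so \<open>H(\<beta>)\<close> is not zero.\<close>
  have "infsum ?f {[0]} \<le> H_fun \<beta>"
    unfolding H_fun_def using sum assms trivial_walk_in_half_plane_saws
    by (intro infsum_mono2) auto
  then have pos: "H_fun \<beta> > 0" by (simp add: steps_def)
  have "(\<integral>\<^sup>+\<omega>. ennreal (?f \<omega> / H_fun \<beta>) \<partial>count_space half_plane_saws)
      = (\<integral>\<^sup>+\<omega>. ennreal (?f \<omega>) \<partial>count_space half_plane_saws) / ennreal (H_fun \<beta>)"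
    using pos assms by (subst nn_integral_divide[symmetric]) (auto simp: divide_ennreal)
  also have "\<dots> = ennreal (H_fun \<beta>) / ennreal (H_fun \<beta>)"
    using assms nn_integral_conv_infsetsum[OF abs] infsetsum_infsum[OF abs]
    by (simp add: H_fun_def)
  also have "\<dots> = 1" using pos by (simp add: divide_ennreal)
  finally show ?thesis .
qed

text \<open>Prepending the given bridges is a bijection from the half-plane walks onto the event, and it
  multiplies every weight by the same constant; the event thus has this constant times the total
  mass \<open>1\<close>.\<close>

lemma measure_half_plane_extensions:
  assumes us: "set us \<subseteq> irreducible_bridges" and \<beta>: "0 < \<beta>" "\<beta> < beta_c"
  shows "measure (P_measure \<beta>) (half_plane_extensions us) = \<beta> ^ (\<Sum>\<omega>\<leftarrow>us. steps \<omega>)"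
proof -
  let ?p = "\<lambda>\<omega>. ennreal (\<beta> ^ steps \<omega> / H_fun \<beta>)"
  let ?L = "\<Sum>\<omega>\<leftarrow>us. steps \<omega>"
  let ?E = "half_plane_extensions us"
  have "bij_betw (foldr (\<otimes>\<^sub>w) us) half_plane_saws ?E"
    unfolding bij_betw_def
  proof
    show "inj_on (foldr (\<otimes>\<^sub>w) us) half_plane_saws"
      using foldr_concat_unique[OF us us] by (auto intro: inj_onI)
    show "foldr (\<otimes>\<^sub>w) us ` half_plane_saws = ?E"
      using foldr_concat_in_half_plane_saws[OF us] by (auto simp: half_plane_extensions_def)
  qed
  then have "(\<integral>\<^sup>+\<omega>. ?p \<omega> \<partial>count_space ?E)
      = (\<integral>\<^sup>+\<omega>. ?p (foldr (\<otimes>\<^sub>w) us \<omega>) \<partial>count_space half_plane_saws)"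
    by (rule nn_integral_bij_count_space[symmetric])
  also have "\<dots> = (\<integral>\<^sup>+\<omega>. ennreal (\<beta> ^ ?L) * ?p \<omega> \<partial>count_space half_plane_saws)"
    using \<beta> us
    by (intro nn_integral_cong)
      (simp add: steps_foldr_concat power_add ennreal_mult'[symmetric])
  also have "\<dots> = ennreal (\<beta> ^ ?L)"
    by (subst nn_integral_cmult) (simp_all add: nn_integral_half_plane_saws[OF \<beta>])
  finally have "emeasure (P_measure \<beta>) ?E = ennreal (\<beta> ^ ?L)"
    unfolding P_measure_def
    by (subst emeasure_point_measure_eq_nn_integral) (auto simp: half_plane_extensions_def)
  then show ?thesis using \<beta> by (simp add: measure_def)
qed

lemma sigma_finite_Q_measure: "sigma_finite_measure Q_measure"
proof -
  interpret sigma_finite_measure "count_space irreducible_bridges"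
    by (rule sigma_finite_measure_count_space_countable) simp
  show ?thesis
    unfolding Q_measure_def point_measure_def
    by (subst sigma_finite_iff_density_finite) auto
qed

text \<open>A finite product of countable sets is countable and its points are measurable, so every subset of
  the product space is measurable. In particular concatenation is a measurable map, without which
  the mass of its image measure would not be given by preimages.\<close>

lemma measure_Q_power:
  assumes us: "set us \<subseteq> irreducible_bridges" and len: "length us = j"
  shows "measure (Q_power j) {walk_concats us} = beta_c ^ (\<Sum>\<omega>\<leftarrow>us. steps \<omega>)"
proof -
  let ?M = "PiM {..<j} (\<lambda>_. Q_measure)"
  let ?g = "\<lambda>w. walk_concats (map w [0..<j])"
  interpret product_sigma_finite "\<lambda>_ :: nat. Q_measure"
    using sigma_finite_Q_measure by (simp add: product_sigma_finite_def)
  have sets_Q: "sets Q_measure = Pow irreducible_bridges"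
    and space_Q: "space Q_measure = irreducible_bridges"
    by (simp_all add: Q_measure_def sets_point_measure space_point_measure)
  have space_M: "space ?M = ({..<j} \<rightarrow>\<^sub>E irreducible_bridges)"
    by (simp add: space_PiM space_Q)
  have singleton: "{w} \<in> sets ?M" if "w \<in> space ?M" for w
  proof -
    have "PiE {..<j} (\<lambda>i. {w i}) \<in> sets ?M"
      using that by (intro sets_PiM_I_finite) (auto simp: sets_Q space_M)
    moreover have "PiE {..<j} (\<lambda>i. {w i}) = {w}"
      using that by (intro PiE_singleton) (auto simp: space_M PiE_def)
    ultimately show ?thesis by simp
  qed
  have sets_M: "X \<in> sets ?M" if X: "X \<subseteq> space ?M" for X
  proof (rule sets.countable)
    have "countable (space ?M)" unfolding space_M by (intro countable_PiE) simp_all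
    with X show "countable X" by (rule countable_subset)
  qed (use X singleton in auto)
  have tuple: "set (map v [0..<j]) \<subseteq> irreducible_bridges" if "v \<in> space ?M" for v
    using that unfolding space_M by (simp add: image_subset_iff PiE_def Pi_iff)
  have meas: "?g \<in> measurable ?M (count_space bridges)"
  proof (rule measurableI)
    fix v assume "v \<in> space ?M"
    then have "set (map v [0..<j]) \<subseteq> irreducible_bridges" by (rule tuple)
    then show "?g v \<in> space (count_space bridges)"
      by (simp only: space_count_space walk_concats_in_bridges)
  next
    fix A :: "walk set"
    show "?g -` A \<inter> space ?M \<in> sets ?M" by (rule sets_M) simp
  qed
  define w where "w = restrict (\<lambda>i. us ! i) {..<j}"
  have w: "w \<in> space ?M"
    using us len by (auto simp: w_def space_M)
  have map_w: "map w [0..<j] = us"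
    using len by (intro nth_equalityI) (auto simp: w_def)
  \<comment> \<open>By unique decomposition, only one tuple is concatenated to this bridge.\<close>
  have "?g -` {walk_concats us} \<inter> space ?M = {w}"
  proof (intro equalityI subsetI)
    fix v assume v: "v \<in> ?g -` {walk_concats us} \<inter> space ?M"
    then have "set (map v [0..<j]) \<subseteq> irreducible_bridges" by (intro tuple) simp
    then have "map v [0..<j] = map w [0..<j]"
      using foldr_concat_unique[of "map v [0..<j]" us "[0]" "[0]"] us len v map_w
        trivial_walk_in_half_plane_saws
      by (auto simp: walk_concats_def)
    then have "v = w"
      using v w unfolding space_M by (intro PiE_ext) auto
    then show "v \<in> {w}" by simp
  qed (use w map_w in auto)
  then have "emeasure (Q_power j) {walk_concats us} = emeasure ?M {w}"
    unfolding Q_power_def using walk_concats_in_bridges[OF us]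
    by (subst emeasure_distr[OF meas]) auto
  also have "{w} = PiE {..<j} (\<lambda>i. {w i})"
    using w by (intro PiE_singleton[symmetric]) (auto simp: space_M PiE_def)
  also have "emeasure ?M \<dots> = (\<Prod>i<j. emeasure Q_measure {w i})"
    using w by (intro emeasure_PiM) (auto simp: sets_Q space_M)
  also have "\<dots> = (\<Prod>i<j. ennreal (beta_c ^ steps (us ! i)))"
  proof (intro prod.cong refl)
    fix i assume i: "i \<in> {..<j}"
    then have "us ! i \<in> irreducible_bridges" using us len by auto
    then show "emeasure Q_measure {w i} = ennreal (beta_c ^ steps (us ! i))"
      unfolding Q_measure_def using i
      by (subst emeasure_point_measure_eq_nn_integral)
        (auto simp: w_def nn_integral_count_space_finite)
  qed
  also have "\<dots> = ennreal (beta_c ^ (\<Sum>i<j. steps (us ! i)))"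
    using beta_c_pos by (simp add: prod_ennreal power_sum)
  also have "(\<Sum>i<j. steps (us ! i)) = (\<Sum>\<omega>\<leftarrow>us. steps \<omega>)"
    using len by (simp add: sum_list_sum_nth atLeast0LessThan)
  finally show ?thesis using beta_c_pos by (simp add: measure_def)
qed

theorem proposition2p2:
  fixes j :: nat and \<omega>s :: "walk list"
  assumes "j \<ge> 1"
    and "length \<omega>s = j"
    and "set \<omega>s \<subseteq> irreducible_bridges"
  shows "(\<forall>\<beta>::real. 0 < \<beta> \<and> \<beta> < beta_c \<longrightarrow>
            measure (P_measure \<beta>) (half_plane_extensions \<omega>s) = \<beta> ^ (\<Sum>\<omega>\<leftarrow>\<omega>s. steps \<omega>))
       \<and> ((\<lambda>\<beta>. measure (P_measure \<beta>) (half_plane_extensions \<omega>s))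
            \<longlongrightarrow> beta_c ^ (\<Sum>\<omega>\<leftarrow>\<omega>s. steps \<omega>)) (at_left beta_c)
       \<and> beta_c ^ (\<Sum>\<omega>\<leftarrow>\<omega>s. steps \<omega>) = measure (Q_power j) {walk_concats \<omega>s}"
proof (intro conjI allI impI)
  let ?L = "\<Sum>\<omega>\<leftarrow>\<omega>s. steps \<omega>"
  show *: "measure (P_measure \<beta>) (half_plane_extensions \<omega>s) = \<beta> ^ ?L"
    if "0 < \<beta> \<and> \<beta> < beta_c" for \<beta>
    using measure_half_plane_extensions[OF assms(3)] that by simp
  have "((\<lambda>\<beta>. \<beta> ^ ?L) \<longlongrightarrow> beta_c ^ ?L) (at_left beta_c)"
    by (intro tendsto_intros)
  moreover have "\<forall>\<^sub>F \<beta> in at_left beta_c. \<beta> ^ ?L = measure (P_measure \<beta>) (half_plane_extensions \<omega>s)"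
    using eventually_at_left_real[OF beta_c_pos] by eventually_elim (use * in auto)
  ultimately show "((\<lambda>\<beta>. measure (P_measure \<beta>) (half_plane_extensions \<omega>s))
      \<longlongrightarrow> beta_c ^ ?L) (at_left beta_c)"
    by (rule Lim_transform_eventually)
  show "beta_c ^ ?L = measure (Q_power j) {walk_concats \<omega>s}"
    using measure_Q_power[OF assms(3,2)] by simp
qed

end
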